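(* Let $m$ be an entire function which is positive on $[0,\infty)$ and has an analytic square root in $\mathbb C$; let $\sqrt m$ denote the entire square root of $m$ which coincides with the positive square root $\sqrt{m(u)}$ for $u\in(0,\infty)$. For $z\in\mathbb C$ let $$X_z=\sum_{n=0}^\infty\left(\int_{[0,z]}\sqrt{m(u)}\,\zeta_n(u)\,du\right)Z_n .$$ Then the process $(X_z)_{z\in\mathbb C}$ is differentiable (i.e. analytic) in $\mathbb C$, as a function with values in $\mathfrak F_{dist}(\mathbf 2)$, with derivative $$\frac{\partial X_z}{\partial z}(z)=\sqrt{m(z)}\,N_z=\sqrt{m(z)}\sum_{n=0}^\infty\zeta_n(z)Z_n,$$ converging (in $\mathfrak F_{dist}(\mathbf 2)$) uniformly on compact subsets of the complex plane.
   Context: Hermite functions: $H_n(z)=(-1)^ne^{z^2}(d/dz)^ne^{-z^2}$ and $\zeta_n(z)=\frac{1}{\pi^{1/4}2^{n/2}(n!)^{1/2}}(-1)^ne^{-z^2/2}H_n(z)$, $n=0,1,\ldots$; these are entire functions, orthonormal in $L_2(\mathbb R,dx)$. For an entire function $h$, $\int_{[0,z]}h(u)\,du$ is the complex line integral along the segment from $0$ to $z$. White noise space: $\mathscr S'_{\mathbb R}$ is the space of real tempered distributions on $\mathbb R$, $\mathcal C$ its cylinder sigma-algebra, and $P$ the probability measure (Bochner–Minlos) with $\int e^{i\langle s,\omega\rangle}dP(\omega)=e^{-\|s\|_2^2/2}$ for all real Schwartz functions $s$. $Z_n(\omega)=\langle\zeta_n,\omega\rangle$, $n=0,1,\ldots$,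 are independent $N(0,1)$ random variables. Let $\ell$ be the set of finitely supported sequences $\alpha=(\alpha_1,\alpha_2,\ldots)$ of non-negative integers, with $\alpha!=\prod_k\alpha_k!$. The functions $H_\alpha=\prod_{k\ge1}h_{\alpha_k}(Z_{k-1})$, where $h_n(x)=(-1)^ne^{x^2/2}(d/dx)^ne^{-x^2/2}$, form an orthogonal basis of $\mathbf L_2(\mathscr S'_{\mathbb R},\mathcal C,P)$ with $\|H_\alpha\|^2=\alpha!$. Elements $\sum_\alpha f_\alpha H_\alpha$ are identified with their coefficient families $(f_\alpha)_{\alpha\in\ell}$; in particular $Z_n$ is identified with the family equal to $1$ at $\alpha^{(n)}$ and $0$ elsewhere, where $\alpha^{(n)}\in\ell$ has $1$ in position $n+1$ and $0$ elsewhere. Thus a series $\sum_n c_nZ_n$ denotes the family with coefficient $c_n$ at $\alpha^{(n)}$ and $0$ at all other $\alpha$. Stochastic distributions: let $b_\alpha=\prod_{k\ge1}(2^k)^{\alpha_k}$. For $p=1,2,\ldots$, $\mathcal F_{-p}$ is the Hilbert space of complex families $(f_\alpha)_{\alpha\in\ell}$ with $\|f\|_{-p}^2=\sum_{\alpha\in\ell}|f_\alpha|^2b_\alpha^{-p}<\infty$, and $\mathfrak F_{dist}(\mathbf 2)=\bigcup_{p\ge1}\mathcal F_{-p}$ with the inductive limit topology. Complex white noise: $N_z=\sum_{n=0}^\infty\zeta_n(z)Z_n$, $z\in\mathbb C$. *)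

theory Defs
  imports "HOL-Complex_Analysis.Complex_Analysis" "HOL-Library.Poly_Mapping"
begin

section \<open>Hermite functions\<close>

definition hermite_H :: "nat \<Rightarrow> complex \<Rightarrow> complex" where
  "hermite_H n z = (-1) ^ n * exp (z ^ 2) * (deriv ^^ n) (\<lambda>w. exp (- (w ^ 2))) z"

definition hermite_zeta :: "nat \<Rightarrow> complex \<Rightarrow> complex" where
  "hermite_zeta n z =
     complex_of_real (1 / (pi powr (1 / 4) * 2 powr (real n / 2) * sqrt (fact n)))
     * (-1) ^ n * exp (- (z ^ 2) / 2) * hermite_H n z"


section \<open>Stochastic distributions\<close>

text \<open>
  A finitely supported sequence of non-negative integers is an element of \<open>nat \<Rightarrow>\<^sub>0 nat\<close>.
  Its positions are numbered from \<open>0\<close>, so that the entry usually written with index \<open>k + 1\<close>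
  is \<open>Poly_Mapping.lookup \<alpha> k\<close>; this is the reason for the exponent \<open>Suc k\<close> in the weight.
  An element of the chaos expansion is represented by the family of its coefficients.
\<close>

type_synonym chaos = "(nat \<Rightarrow>\<^sub>0 nat) \<Rightarrow> complex"

definition chaos_weight :: "(nat \<Rightarrow>\<^sub>0 nat) \<Rightarrow> real" where
  "chaos_weight \<alpha> = (\<Prod>k\<in>Poly_Mapping.keys \<alpha>. (2 ^ Suc k) ^ Poly_Mapping.lookup \<alpha> k)"

definition chaos_space :: "nat \<Rightarrow> chaos set" where
  "chaos_space p = {f. (\<lambda>\<alpha>. (cmod (f \<alpha>))\<^sup>2 / chaos_weight \<alpha> ^ p) summable_on UNIV}"

text \<open>Only meaningful on \<open>chaos_space p\<close>, since \<open>infsum\<close> of a divergent family is \<open>0\<close>.\<close>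

definition chaos_norm :: "nat \<Rightarrow> chaos \<Rightarrow> real" where
  "chaos_norm p f = sqrt (\<Sum>\<^sub>\<infinity>\<alpha>. (cmod (f \<alpha>))\<^sup>2 / chaos_weight \<alpha> ^ p)"

definition chaos_dist :: "chaos set" where
  "chaos_dist = (\<Union>p\<in>{1..}. chaos_space p)"

text \<open>
  The inductive limit topology is the finest locally convex topology for which all inclusions
  of the Hilbert spaces \<open>chaos_space p\<close> are continuous. A base of its neighbourhoods of \<open>0\<close> is given
  by the absolutely convex sets whose trace on every \<open>chaos_space p\<close> is a neighbourhood of \<open>0\<close>
  there (such a set is automatically absorbing).
\<close>

definition absolutely_convex :: "chaos set \<Rightarrow> bool" where
  "absolutely_convex V \<longleftrightarrow>
     (\<forall>f\<in>V. \<forall>g\<in>V. \<forall>a b. cmod a + cmod b \<le> 1 \<longrightarrow> (\<lambda>\<alpha>. a * f \<alpha> + b * g \<alpha>) \<in> V)"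

definition chaos_basic_nhd :: "chaos set \<Rightarrow> bool" where
  "chaos_basic_nhd V \<longleftrightarrow> V \<subseteq> chaos_dist \<and> absolutely_convex V \<and>
     (\<forall>p\<ge>1. \<exists>e>0. \<forall>f\<in>chaos_space p. chaos_norm p f < e \<longrightarrow> f \<in> V)"

definition chaos_open :: "chaos set \<Rightarrow> bool" where
  "chaos_open U \<longleftrightarrow> U \<subseteq> chaos_dist \<and>
     (\<forall>f\<in>U. \<exists>V. chaos_basic_nhd V \<and> (\<forall>h\<in>V. (\<lambda>\<alpha>. f \<alpha> + h \<alpha>) \<in> U))"

definition chaos_topology :: "chaos topology" where
  "chaos_topology = topology chaos_open"

lemma openin_chaos_topology: "openin chaos_topology U \<longleftrightarrow> chaos_open U"
proof -
  have int: "chaos_basic_nhd (V \<inter> W)" if V: "chaos_basic_nhd V" and W: "chaos_basic_nhd W" for V W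
  proof -
    have "\<exists>e>0. \<forall>f\<in>chaos_space p. chaos_norm p f < e \<longrightarrow> f \<in> V \<inter> W" if "p \<ge> 1" for p
    proof -
      have "\<exists>d>0. \<forall>f\<in>chaos_space p. chaos_norm p f < d \<longrightarrow> f \<in> V"
        using V that by (simp add: chaos_basic_nhd_def)
      moreover have "\<exists>e>0. \<forall>f\<in>chaos_space p. chaos_norm p f < e \<longrightarrow> f \<in> W"
        using W that by (simp add: chaos_basic_nhd_def)
      ultimately obtain d e where d: "d > 0" "\<forall>f\<in>chaos_space p. chaos_norm p f < d \<longrightarrow> f \<in> V"
        and e: "e > 0" "\<forall>f\<in>chaos_space p. chaos_norm p f < e \<longrightarrow> f \<in> W"
        by (elim exE conjE)
      from d e show ?thesis by (intro exI[of _ "min d e"]) auto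
    qed
    moreover have "V \<inter> W \<subseteq> chaos_dist"
      using V unfolding chaos_basic_nhd_def by (simp add: le_infI1)
    moreover have "absolutely_convex (V \<inter> W)"
      using V W unfolding chaos_basic_nhd_def absolutely_convex_def by simp
    ultimately show ?thesis
      by (simp add: chaos_basic_nhd_def)
  qed
  have "istopology chaos_open"
    unfolding istopology_def
  proof (intro conjI allI impI)
    fix S T assume S: "chaos_open S" and T: "chaos_open T"
    show "chaos_open (S \<inter> T)"
      unfolding chaos_open_def
    proof (intro conjI ballI)
      show "S \<inter> T \<subseteq> chaos_dist" using S unfolding chaos_open_def by auto
    next
      fix f assume f: "f \<in> S \<inter> T"
      obtain V where V: "chaos_basic_nhd V" "\<forall>h\<in>V. (\<lambda>\<alpha>. f \<alpha> + h \<alpha>) \<in> S"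
        using S f unfolding chaos_open_def by blast
      obtain W where W: "chaos_basic_nhd W" "\<forall>h\<in>W. (\<lambda>\<alpha>. f \<alpha> + h \<alpha>) \<in> T"
        using T f unfolding chaos_open_def by blast
      show "\<exists>V. chaos_basic_nhd V \<and> (\<forall>h\<in>V. (\<lambda>\<alpha>. f \<alpha> + h \<alpha>) \<in> S \<inter> T)"
        using V(2) W(2) int[OF V(1) W(1)] by (intro exI[of _ "V \<inter> W"]) simp
    qed
  next
    fix \<K> assume K: "\<forall>K\<in>\<K>. chaos_open K"
    show "chaos_open (\<Union>\<K>)"
      unfolding chaos_open_def
    proof (intro conjI ballI)
      show "\<Union>\<K> \<subseteq> chaos_dist" using K unfolding chaos_open_def by auto
    next
      fix f assume "f \<in> \<Union>\<K>"
      then obtain A where A: "A \<in> \<K>" "f \<in> A" by auto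
      then have "chaos_open A" using K by simp
      then obtain V where "chaos_basic_nhd V" "\<forall>h\<in>V. (\<lambda>\<alpha>. f \<alpha> + h \<alpha>) \<in> A"
        using A(2) unfolding chaos_open_def by blast
      then show "\<exists>V. chaos_basic_nhd V \<and> (\<forall>h\<in>V. (\<lambda>\<alpha>. f \<alpha> + h \<alpha>) \<in> \<Union>\<K>)"
        using A(1) by (intro exI[of _ V]) auto
    qed
  qed
  then show ?thesis by (simp add: chaos_topology_def topology_inverse')
qed

lemma chaos_weight_ge_1: "chaos_weight \<alpha> \<ge> 1"
  unfolding chaos_weight_def by (intro prod_ge_1 one_le_power) simp

lemma chaos_space_mono:
  assumes "p \<le> q" shows "chaos_space p \<subseteq> chaos_space q"
proof
  fix f assume "f \<in> chaos_space p"
  then have "(\<lambda>\<alpha>. (cmod (f \<alpha>))\<^sup>2 / chaos_weight \<alpha> ^ p) summable_on UNIV"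
    by (simp add: chaos_space_def)
  moreover have "(cmod (f \<alpha>))\<^sup>2 / chaos_weight \<alpha> ^ q \<le> (cmod (f \<alpha>))\<^sup>2 / chaos_weight \<alpha> ^ p" for \<alpha>
    using chaos_weight_ge_1[of \<alpha>] assms by (intro divide_left_mono power_increasing) auto
  moreover have "(cmod (f \<alpha>))\<^sup>2 / chaos_weight \<alpha> ^ q \<ge> 0" for \<alpha>
    using chaos_weight_ge_1[of \<alpha>] by simp
  ultimately show "f \<in> chaos_space q"
    unfolding chaos_space_def mem_Collect_eq by (rule summable_on_comparison_test)
qed

lemma chaos_space_lincomb:
  assumes "f \<in> chaos_space p" "g \<in> chaos_space p"
  shows "(\<lambda>\<alpha>. a * f \<alpha> + b * g \<alpha>) \<in> chaos_space p"
proof -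
  let ?w = "\<lambda>\<alpha>. chaos_weight \<alpha> ^ p"
  have "(\<lambda>\<alpha>. 2 * (cmod a)\<^sup>2 * ((cmod (f \<alpha>))\<^sup>2 / ?w \<alpha>)
            + 2 * (cmod b)\<^sup>2 * ((cmod (g \<alpha>))\<^sup>2 / ?w \<alpha>)) summable_on UNIV"
    using assms unfolding chaos_space_def
    by (intro summable_on_add summable_on_cmult_right) auto
  moreover have "(cmod (a * f \<alpha> + b * g \<alpha>))\<^sup>2 / ?w \<alpha> \<le>
      2 * (cmod a)\<^sup>2 * ((cmod (f \<alpha>))\<^sup>2 / ?w \<alpha>) + 2 * (cmod b)\<^sup>2 * ((cmod (g \<alpha>))\<^sup>2 / ?w \<alpha>)" for \<alpha>
  proof -
    have "cmod (a * f \<alpha> + b * g \<alpha>) \<le> cmod a * cmod (f \<alpha>) + cmod b * cmod (g \<alpha>)"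
      by (metis norm_mult norm_triangle_ineq)
    then have "(cmod (a * f \<alpha> + b * g \<alpha>))\<^sup>2 \<le> (cmod a * cmod (f \<alpha>) + cmod b * cmod (g \<alpha>))\<^sup>2"
      by (intro power_mono) auto
    also have "\<dots> \<le> 2 * (cmod a * cmod (f \<alpha>))\<^sup>2 + 2 * (cmod b * cmod (g \<alpha>))\<^sup>2"
      using sum_squares_bound[of "cmod a * cmod (f \<alpha>)" "cmod b * cmod (g \<alpha>)"]
      by (simp add: power2_sum)
    finally have "(cmod (a * f \<alpha> + b * g \<alpha>))\<^sup>2 / ?w \<alpha> \<le>
        (2 * (cmod a * cmod (f \<alpha>))\<^sup>2 + 2 * (cmod b * cmod (g \<alpha>))\<^sup>2) / ?w \<alpha>"
      using chaos_weight_ge_1[of \<alpha>] by (intro divide_right_mono) auto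
    then show ?thesis by (simp add: power_mult_distrib add_divide_distrib mult.assoc)
  qed
  moreover have "(cmod (a * f \<alpha> + b * g \<alpha>))\<^sup>2 / ?w \<alpha> \<ge> 0" for \<alpha>
    using chaos_weight_ge_1[of \<alpha>] by simp
  ultimately show ?thesis
    unfolding chaos_space_def mem_Collect_eq
    by (rule summable_on_comparison_test)
qed

lemma chaos_dist_lincomb:
  assumes "f \<in> chaos_dist" "g \<in> chaos_dist"
  shows "(\<lambda>\<alpha>. a * f \<alpha> + b * g \<alpha>) \<in> chaos_dist"
proof -
  obtain p q where "p \<ge> 1" "f \<in> chaos_space p" and "q \<ge> 1" "g \<in> chaos_space q"
    using assms unfolding chaos_dist_def by auto
  then have "f \<in> chaos_space (max p q)" "g \<in> chaos_space (max p q)" "max p q \<ge> 1"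
    using chaos_space_mono[of p "max p q"] chaos_space_mono[of q "max p q"] by auto
  then show ?thesis
    unfolding chaos_dist_def using chaos_space_lincomb by (meson UN_I atLeast_iff)
qed

lemma topspace_chaos_topology: "topspace chaos_topology = chaos_dist"
proof
  show "topspace chaos_topology \<subseteq> chaos_dist"
    using openin_topspace[of chaos_topology] unfolding openin_chaos_topology chaos_open_def by blast
  have "chaos_basic_nhd chaos_dist"
    unfolding chaos_basic_nhd_def absolutely_convex_def
  proof (intro conjI ballI allI impI)
    fix p :: nat assume "p \<ge> 1"
    then show "\<exists>e>0. \<forall>f\<in>chaos_space p. chaos_norm p f < e \<longrightarrow> f \<in> chaos_dist"
      by (intro exI[of _ 1]) (auto simp: chaos_dist_def)
  qed (simp_all add: chaos_dist_lincomb)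
  then have "chaos_open chaos_dist"
    unfolding chaos_open_def
    using chaos_dist_lincomb[where a = 1 and b = 1] by (simp, blast)
  then show "chaos_dist \<subseteq> topspace chaos_topology"
    by (simp add: openin_chaos_topology openin_subset)
qed


section \<open>Limits in the space of stochastic distributions\<close>

text \<open>
  \<open>limitin\<close> demands that the limit lies in \<open>chaos_dist\<close> and that the difference
  quotients eventually do.
\<close>

definition has_chaos_derivative :: "(complex \<Rightarrow> chaos) \<Rightarrow> chaos \<Rightarrow> complex \<Rightarrow> bool" where
  "has_chaos_derivative X D z \<longleftrightarrow>
     limitin chaos_topology (\<lambda>w. (\<lambda>\<alpha>. (X w \<alpha> - X z \<alpha>) / (w - z))) D (at z)"

definition chaos_uniform_limit ::
    "complex set \<Rightarrow> (nat \<Rightarrow> complex \<Rightarrow> chaos) \<Rightarrow> (complex \<Rightarrow> chaos) \<Rightarrow> bool" where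
  "chaos_uniform_limit K S L \<longleftrightarrow>
     (\<forall>z\<in>K. L z \<in> chaos_dist) \<and> (\<forall>N. \<forall>z\<in>K. S N z \<in> chaos_dist) \<and>
     (\<forall>V. openin chaos_topology V \<and> (\<lambda>_. 0) \<in> V \<longrightarrow>
        (\<forall>\<^sub>F N in sequentially. \<forall>z\<in>K. (\<lambda>\<alpha>. S N z \<alpha> - L z \<alpha>) \<in> V))"


section \<open>Series in the coordinate random variables\<close>

definition chaos_Z :: "nat \<Rightarrow> chaos" where
  "chaos_Z n = (\<lambda>\<alpha>. if \<alpha> = Poly_Mapping.single n 1 then 1 else 0)"

text \<open>The series is formed coefficientwise; at every index at most one term is nonzero.\<close>

definition chaos_series :: "(nat \<Rightarrow> complex) \<Rightarrow> chaos" where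
  "chaos_series c = (\<lambda>\<alpha>. suminf (\<lambda>n. c n * chaos_Z n \<alpha>))"

lemma chaos_series_single: "chaos_series c (Poly_Mapping.single n 1) = c n"
proof -
  have "c k * chaos_Z k (Poly_Mapping.single n 1) = (if k = n then c n else 0)" for k
    by (metis chaos_Z_def lookup_single_eq lookup_single_not_eq mult.right_neutral
        mult_zero_right zero_neq_one)
  then have "chaos_series c (Poly_Mapping.single n 1) = suminf (\<lambda>k. if k = n then c n else 0)"
    by (simp add: chaos_series_def)
  also have "\<dots> = c n"
    using sums_single[of n "\<lambda>_. c n"] sums_unique by metis
  finally show ?thesis .
qed

lemma chaos_series_other:
  assumes "\<And>n. \<alpha> \<noteq> Poly_Mapping.single n 1"
  shows "chaos_series c \<alpha> = 0"
  using assms by (simp add: chaos_series_def chaos_Z_def)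

definition complex_white_noise :: "complex \<Rightarrow> chaos" where
  "complex_white_noise z = chaos_series (\<lambda>n. hermite_zeta n z)"


section \<open>The process\<close>

definition is_entire_sqrt :: "(complex \<Rightarrow> complex) \<Rightarrow> (complex \<Rightarrow> complex) \<Rightarrow> bool" where
  "is_entire_sqrt m r \<longleftrightarrow> r holomorphic_on UNIV \<and> (\<forall>z. (r z)\<^sup>2 = m z) \<and>
     (\<forall>u::real. u > 0 \<longrightarrow> r (of_real u) = of_real (sqrt (Re (m (of_real u)))))"

definition entire_sqrt :: "(complex \<Rightarrow> complex) \<Rightarrow> complex \<Rightarrow> complex" where
  "entire_sqrt m = (THE r. is_entire_sqrt m r)"

lemma is_entire_sqrt_entire_sqrt:
  assumes pos: "\<And>x::real. x \<ge> 0 \<Longrightarrow> m (of_real x) \<in> \<real> \<and> Re (m (of_real x)) > 0"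
    and g: "g holomorphic_on UNIV" "\<And>z. (g z)\<^sup>2 = m z"
  shows "is_entire_sqrt m (entire_sqrt m)"
proof -
  have real: "Im (g (of_real x)) = 0" if "x \<ge> 0" for x :: real
  proof (rule ccontr)
    assume "Im (g (of_real x)) \<noteq> 0"
    moreover have "Im ((g (of_real x))\<^sup>2) = 0" "Re ((g (of_real x))\<^sup>2) > 0"
      using pos[OF that] by (auto simp: g(2) complex_is_Real_iff)
    ultimately show False by (auto simp: power2_eq_square mult_less_0_iff not_le)
  qed
  have sq: "(Re (g (of_real x)))\<^sup>2 = Re (m (of_real x))" if "x \<ge> 0" for x :: real
    using real[OF that] arg_cong[OF g(2)[of "of_real x"], of Re] by (simp add: power2_eq_square)
  have nz: "Re (g (of_real x)) \<noteq> 0" if "x \<ge> 0" for x :: real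
    using sq[OF that] pos[OF that] by auto
  have cont: "continuous_on A (\<lambda>x. Re (g (of_real x)))" for A :: "real set"
    by (intro continuous_intros continuous_on_compose2[OF holomorphic_on_imp_continuous_on[OF g(1)]]) auto
  define s :: real where "s = sgn (Re (g 0))"
  have sgn: "sgn (Re (g (of_real x))) = s" if "x \<ge> 0" for x :: real
  proof (rule ccontr)
    assume ne: "sgn (Re (g (of_real x))) \<noteq> s"
    have "\<exists>y\<ge>0. y \<le> x \<and> Re (g (of_real y)) = 0"
    proof (cases "Re (g 0) < 0")
      case True
      then have "Re (g (of_real x)) \<ge> 0" using ne unfolding s_def by (auto simp: sgn_if split: if_splits)
      then show ?thesis
        using IVT'[of "\<lambda>x. Re (g (of_real x))" 0 0 x] True that cont by auto
    next
      case False
      then have "Re (g (of_real x)) \<le> 0" using ne nz[of 0] unfolding s_def by (auto simp: sgn_if split: if_splits)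
      then show ?thesis
        using IVT2'[of "\<lambda>x. Re (g (of_real x))" x 0 0] False that cont by auto
    qed
    then show False using nz by blast
  qed
  have s: "s = 1 \<or> s = -1" using nz[of 0] by (auto simp: s_def sgn_if)
  have ex: "is_entire_sqrt m (\<lambda>z. of_real s * g z)"
    unfolding is_entire_sqrt_def
  proof (intro conjI allI impI)
    show "(\<lambda>z. of_real s * g z) holomorphic_on UNIV"
      using g(1) by (intro holomorphic_intros)
    show "(of_real s * g z)\<^sup>2 = m z" for z
      using s g(2) by auto
    fix u :: real assume u: "u > 0"
    have "sqrt (Re (m (of_real u))) = \<bar>Re (g (of_real u))\<bar>"
      using sq[of u] u by (metis less_imp_le real_sqrt_abs)
    also have "\<dots> = s * Re (g (of_real u))"
      using sgn[of u] u by (simp add: abs_sgn mult.commute)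
    finally show "of_real s * g (of_real u) = of_real (sqrt (Re (m (of_real u))))"
      using real[of u] u by (simp add: complex_eq_iff)
  qed
  have "r = r'" if r: "is_entire_sqrt m r" and r': "is_entire_sqrt m r'" for r r'
  proof
    fix z
    have "r z - r' z = 0"
    proof (rule analytic_continuation[where f = "\<lambda>z. r z - r' z" and U = "of_real ` {0<..}" and S = UNIV and \<xi> = 1])
      show "(\<lambda>z. r z - r' z) holomorphic_on UNIV"
        using r r' unfolding is_entire_sqrt_def by (intro holomorphic_intros) auto
      show "(1::complex) islimpt of_real ` {0<..}"
        unfolding islimpt_approachable
      proof (intro allI impI)
        fix e :: real assume "e > 0"
        then show "\<exists>x'\<in>complex_of_real ` {0<..}. x' \<noteq> 1 \<and> dist x' 1 < e"
          by (intro bexI[of _ "of_real (1 + e / 2)"] imageI) (auto simp: dist_norm)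
      qed
      show "r z - r' z = 0" if "z \<in> of_real ` {0<..}" for z
        using that r r' unfolding is_entire_sqrt_def by auto
    qed auto
    then show "r z = r' z" by simp
  qed
  with ex show ?thesis unfolding entire_sqrt_def by (intro theI[of "is_entire_sqrt m"]) auto
qed

definition noise_process :: "(complex \<Rightarrow> complex) \<Rightarrow> complex \<Rightarrow> chaos" where
  "noise_process m z =
     chaos_series (\<lambda>n. contour_integral (linepath 0 z) (\<lambda>u. entire_sqrt m u * hermite_zeta n u))"

end

theory Submission
  imports Defs
begin

text \<open>
  Cauchy's inequality for the derivatives of \<open>exp (- w\<^sup>2)\<close> on a circle of radius \<open>sqrt (n + 1)\<close>
  bounds \<open>hermite_zeta n\<close> on the disc of radius \<open>R\<close> by \<open>C R * 9 ^ n\<close>. The weight of the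
  \<open>n\<close>-th coordinate variable is \<open>2 ^ (n + 1)\<close>, so all the series in question live in the single
  Hilbert space with \<open>p = 7\<close>, where \<open>10\<^sup>2 < 2 ^ 7\<close>; the slack between \<open>9\<close> and \<open>10\<close> makes the tails
  small uniformly on the disc. Taylor's formula with Cauchy's inequality for the second derivative
  bounds the coefficients of the difference quotient minus the derivative by
  \<open>norm (w - z) * C * 9 ^ n\<close>.
\<close>

section \<open>Growth of the Hermite functions\<close>

lemma hermite_zeta_holomorphic: "hermite_zeta n holomorphic_on UNIV"
proof -
  have "(deriv ^^ n) (\<lambda>w::complex. exp (- (w ^ 2))) holomorphic_on UNIV"
    by (intro holomorphic_higher_deriv holomorphic_intros) auto
  then show ?thesis
    unfolding hermite_zeta_def[abs_def] hermite_H_def[abs_def]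
    by (intro holomorphic_intros) auto
qed

text \<open>Cauchy's inequality on the circle of radius \<open>r\<close> about \<open>z\<close>,
  where the Gaussian is bounded crudely by the exponential of the squared modulus. The radius stays
  free so that it can later grow with \<open>n\<close>.\<close>

lemma norm_higher_deriv_gaussian_le:
  assumes "r > 0"
  shows "cmod ((deriv ^^ n) (\<lambda>w. exp (- (w ^ 2))) z) \<le> fact n * exp ((cmod z + r)\<^sup>2) / r ^ n"
proof (rule Cauchy_inequality)
  show "(\<lambda>w::complex. exp (- (w ^ 2))) holomorphic_on ball z r"
    by (intro holomorphic_intros)
  show "continuous_on (cball z r) (\<lambda>w::complex. exp (- (w ^ 2)))"
    by (intro continuous_intros)
  show "r > 0" by fact
  fix x assume "cmod (z - x) = r"
  then have "cmod x \<le> cmod z + r"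
    using norm_triangle_sub[of x z] by (simp add: norm_minus_commute)
  then have "cmod (- (x ^ 2)) \<le> (cmod z + r)\<^sup>2"
    by (simp add: norm_power power_mono)
  then show "cmod (exp (- (x ^ 2))) \<le> exp ((cmod z + r)\<^sup>2)"
    using norm_exp[of "- (x ^ 2)"] by (meson exp_le_cancel_iff order_trans)
qed

text \<open>For a radius near sqrt n, the power of the radius in Cauchy's inequality and the
  normalising 1 / sqrt (n!) together absorb the factor n!. The price is exp (2 n), hence the base 9,
  which exceeds \<open>exp 2\<close>. In the exponent 4 R^2 + 2, each of the two exponential
  prefactors contributes R^2; the rest comes from the circle.\<close>

lemma norm_hermite_zeta_le:
  assumes "cmod z \<le> R"
  shows "cmod (hermite_zeta n z) \<le> exp (4 * R\<^sup>2 + 2) * 9 ^ n"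
proof -
  \<comment> \<open>The shift by 1 keeps the radius positive for \<open>n = 0\<close>.\<close>
  define s where "s = sqrt (real n + 1)"
  have s: "s > 0" "s\<^sup>2 = real n + 1" by (auto simp: s_def)
  have R: "0 \<le> R" using assms norm_ge_zero order_trans by blast
  have zR: "(cmod z)\<^sup>2 \<le> R\<^sup>2" using assms by (simp add: power_mono)
  let ?c = "1 / (pi powr (1 / 4) * 2 powr (real n / 2) * sqrt (fact n))"
  \<comment> \<open>The factors with \<open>pi\<close> and 2 are at least 1 and are given away; only
    the factorial must be kept.\<close>
  have c: "0 \<le> ?c" "?c \<le> 1 / sqrt (fact n)"
  proof -
    have "1 \<le> pi powr (1 / 4)" using pi_gt3 by (intro ge_one_powr_ge_zero) auto
    moreover have "1 \<le> 2 powr (real n / 2)" by (intro ge_one_powr_ge_zero) auto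
    ultimately have "1 * 1 \<le> pi powr (1 / 4) * 2 powr (real n / 2)"
      by (intro mult_mono) auto
    then have "sqrt (fact n) \<le> pi powr (1 / 4) * 2 powr (real n / 2) * sqrt (fact n)"
      by simp
    then show "?c \<le> 1 / sqrt (fact n)"
      by (intro divide_left_mono) auto
  qed auto
  have fact_le: "sqrt (fact n) \<le> s ^ n"
  proof (rule real_le_lsqrt)
    have "(fact n :: real) \<le> real n ^ n"
      using fact_le_power[of n] by simp
    also have "\<dots> \<le> (real n + 1) ^ n" by (intro power_mono) auto
    also have "\<dots> = (s ^ n)\<^sup>2" by (metis s(2) power_mult mult.commute)
    finally show "(fact n :: real) \<le> (s ^ n)\<^sup>2" .
  qed (use s in auto)
  have e1: "cmod (exp (- (z ^ 2) / 2)) \<le> exp (R\<^sup>2)"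
  proof -
    have "cmod (- (z ^ 2) / 2) \<le> R\<^sup>2"
      using zR by (simp add: norm_divide norm_power) (use zero_le_power2[of R] in linarith)
    then show ?thesis using norm_exp by (meson exp_le_cancel_iff order_trans)
  qed
  have e2: "cmod (exp (z ^ 2)) \<le> exp (R\<^sup>2)"
    using norm_exp[of "z ^ 2"] zR by (simp add: norm_power order_trans)
  have e3: "cmod ((deriv ^^ n) (\<lambda>w. exp (- (w ^ 2))) z)
      \<le> fact n * exp (2 * R\<^sup>2 + 2 * real n + 2) / s ^ n"
  proof -
    have "(cmod z + s)\<^sup>2 \<le> (R + s)\<^sup>2" using assms s by (intro power_mono) auto
    also have "\<dots> \<le> 2 * R\<^sup>2 + 2 * s\<^sup>2"
      using sum_squares_bound[of R s] by (simp add: power2_sum)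
    finally have "exp ((cmod z + s)\<^sup>2) \<le> exp (2 * R\<^sup>2 + 2 * real n + 2)" using s by simp
    then have "fact n * exp ((cmod z + s)\<^sup>2) / s ^ n
        \<le> fact n * exp (2 * R\<^sup>2 + 2 * real n + 2) / s ^ n"
      using s by (intro divide_right_mono mult_left_mono) auto
    then show ?thesis using norm_higher_deriv_gaussian_le[OF s(1), of n z] by linarith
  qed
  have "cmod (hermite_zeta n z) = ?c * (cmod (exp (- (z ^ 2) / 2)) * (cmod (exp (z ^ 2))
      * cmod ((deriv ^^ n) (\<lambda>w. exp (- (w ^ 2))) z)))"
    unfolding hermite_zeta_def hermite_H_def norm_mult norm_power norm_of_real
    using c(1) by (simp only: abs_of_nonneg norm_minus_cancel norm_one power_one mult_1_left mult_1_right mult.assoc)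
  also have "\<dots> \<le> 1 / sqrt (fact n) * (exp (R\<^sup>2) * (exp (R\<^sup>2)
      * (fact n * exp (2 * R\<^sup>2 + 2 * real n + 2) / s ^ n)))"
    by (intro mult_mono c e1 e2 e3) (use s in auto)
  also have "\<dots> = exp (4 * R\<^sup>2 + 2) * exp 2 ^ n * (fact n / (sqrt (fact n) * s ^ n))"
  proof -
    have "exp (R\<^sup>2) * (exp (R\<^sup>2) * exp (2 * R\<^sup>2 + 2 * real n + 2)) = exp (4 * R\<^sup>2 + 2) * exp 2 ^ n"
      by (simp add: exp_add[symmetric] exp_of_nat_mult[symmetric])
    then show ?thesis by (simp add: field_simps)
  qed
  also have "\<dots> \<le> exp (4 * R\<^sup>2 + 2) * 9 ^ n * 1"
  proof (intro mult_mono)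
    have "(fact n :: real) = sqrt (fact n) * sqrt (fact n)" by simp
    also have "\<dots> \<le> sqrt (fact n) * s ^ n" using fact_le by (intro mult_left_mono) auto
    finally show "fact n / (sqrt (fact n) * s ^ n) \<le> 1" using s by simp
    have "exp (2::real) = exp 1 * exp 1" by (simp flip: exp_add)
    also have "\<dots> \<le> 3 * 3" by (intro mult_mono exp_le) auto
    finally show "exp (2::real) ^ n \<le> 9 ^ n" by (intro power_mono) auto
  qed (use s in auto)
  finally show ?thesis by simp
qed


section \<open>Series with geometrically bounded coefficients\<close>

text \<open>Each index meets at most one coordinate variable, so identities between series reduce to
  identities between coefficients. The position \<open>n\<close> is chosen before \<open>c\<close>,
  so that one \<open>n\<close> serves all series in such an identity.\<close>

lemma chaos_index_cases:
  obtains n where "\<And>c. chaos_series c \<alpha> = c n"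
      "\<And>k. chaos_Z k \<alpha> = (if k = n then 1 else 0)"
  | "\<And>c. chaos_series c \<alpha> = 0" "\<And>k. chaos_Z k \<alpha> = 0"
proof (cases "\<exists>n. \<alpha> = Poly_Mapping.single n 1")
  case True
  then obtain n where n: "\<alpha> = Poly_Mapping.single n 1" by blast
  have "chaos_Z k \<alpha> = (if k = n then 1 else 0)" for k
    by (metis n chaos_Z_def lookup_single_eq lookup_single_not_eq zero_neq_one)
  then show ?thesis using that(1) n chaos_series_single by blast
next
  case False
  then show ?thesis using that(2) chaos_series_other by (auto simp: chaos_Z_def)
qed

lemma chaos_weight_single: "chaos_weight (Poly_Mapping.single n 1) = 2 ^ Suc n"
  by (simp add: chaos_weight_def)

text \<open>Only the weights 2 ^ (n + 1) enter, so the squared norm is dominated by a geometric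
  series of ratio q^2 / 2^p with sum B^2 / (2^p - q^2).\<close>

lemma chaos_series_geometric:
  assumes c: "\<And>n. cmod (c n) \<le> B * q ^ n" and q: "q\<^sup>2 < 2 ^ p"
  shows "chaos_series c \<in> chaos_space p"
    and "chaos_norm p (chaos_series c) \<le> B / sqrt (2 ^ p - q\<^sup>2)"
proof -
  have B: "B \<ge> 0" using c[of 0] norm_ge_zero[of "c 0"] by (simp, linarith)
  let ?f = "\<lambda>\<alpha>. (cmod (chaos_series c \<alpha>))\<^sup>2 / chaos_weight \<alpha> ^ p"
  let ?e = "\<lambda>n. Poly_Mapping.single n (1::nat)"
  \<comment> \<open>The leading 1 / 2^p is due to the exponent \<open>Suc n\<close> in the
    weight.\<close>
  let ?g = "\<lambda>n. B\<^sup>2 / 2 ^ p * (q\<^sup>2 / 2 ^ p) ^ n"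
  have inj: "inj ?e"
    by (rule injI) (metis lookup_single_eq lookup_single_not_eq zero_neq_one)
  have f: "?f (?e n) = (cmod (c n))\<^sup>2 / (2 ^ Suc n) ^ p" for n
    by (simp only: chaos_series_single chaos_weight_single)
  have le: "?f (?e n) \<le> ?g n" for n
  proof -
    have "(cmod (c n))\<^sup>2 \<le> (B * q ^ n)\<^sup>2" using c by (intro power_mono) auto
    then have "?f (?e n) \<le> (B * q ^ n)\<^sup>2 / (2 ^ Suc n) ^ p"
      unfolding f by (intro divide_right_mono) auto
    also have "(2 ^ Suc n) ^ p = (2 ^ p * (2 ^ p) ^ n :: real)"
      by (simp add: power_mult_distrib power_commutes flip: power_mult)
    also have "(B * q ^ n)\<^sup>2 / (2 ^ p * (2 ^ p) ^ n) = ?g n"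
      by (simp add: power_mult_distrib power_divide flip: power_mult) (simp add: mult.commute)
    finally show ?thesis .
  qed
  have "?g sums (B\<^sup>2 / 2 ^ p * (1 / (1 - q\<^sup>2 / 2 ^ p)))"
    using q by (intro sums_mult geometric_sums) simp
  also have "B\<^sup>2 / 2 ^ p * (1 / (1 - q\<^sup>2 / 2 ^ p)) = B\<^sup>2 / (2 ^ p - q\<^sup>2)"
    using q by (simp add: field_simps)
  \<comment> \<open>Nonnegative terms turn the ordered sum into the unconditional one required by
    \<open>summable_on\<close> and \<open>infsum\<close>.\<close>
  finally have g: "(?g has_sum B\<^sup>2 / (2 ^ p - q\<^sup>2)) UNIV"
    by (intro sums_nonneg_imp_has_sum) auto
  have fe: "(?f \<circ> ?e) summable_on UNIV"
    by (rule summable_on_comparison_test[OF has_sum_imp_summable[OF g]]) (simp_all only: o_def le, simp only: f, simp)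
  then have "?f summable_on range ?e"
    using summable_on_reindex[OF inj, of ?f] by simp
  moreover have zero: "?f \<alpha> = 0" if "\<alpha> \<notin> range ?e" for \<alpha>
    using that chaos_series_other[of \<alpha> c] by auto
  ultimately have "?f summable_on UNIV"
    using summable_on_cong_neutral[of "range ?e" UNIV ?f ?f] by auto
  then show "chaos_series c \<in> chaos_space p" by (simp add: chaos_space_def)
  have "infsum ?f UNIV = infsum ?f (range ?e)"
    by (rule infsum_cong_neutral) (use zero in auto)
  also have "\<dots> = infsum (?f \<circ> ?e) UNIV"
    by (rule infsum_reindex[OF inj])
  also have "\<dots> \<le> infsum ?g UNIV"
    by (rule infsum_mono[OF fe has_sum_imp_summable[OF g]]) (simp only: o_def le)
  also have "\<dots> = B\<^sup>2 / (2 ^ p - q\<^sup>2)" by (rule infsumI[OF g])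
  finally show "chaos_norm p (chaos_series c) \<le> B / sqrt (2 ^ p - q\<^sup>2)"
    unfolding chaos_norm_def using B
    by (metis real_sqrt_le_mono real_sqrt_divide real_sqrt_unique)
qed

lemma chaos_series_geometric_in_dist:
  assumes "\<And>n. cmod (c n) \<le> B * 10 ^ n"
  shows "chaos_series c \<in> chaos_dist"
  unfolding chaos_dist_def
  by (rule UN_I[of 7]) (use chaos_series_geometric(1)[of c B 10 7] assms in auto)

text \<open>A basic neighbourhood contains a ball of the Hilbert space with \<open>p = 7\<close>.
  Convergence in the inductive limit thus reduces to making the single constant \<open>B\<close>
  small.\<close>

lemma chaos_basic_nhd_geometric:
  assumes "chaos_basic_nhd V"
  obtains d where "d > 0" "\<And>c B. (\<And>n. cmod (c n) \<le> B * 10 ^ n) \<Longrightarrow> B < d \<Longrightarrow> chaos_series c \<in> V"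
proof -
  have "\<exists>e>0. \<forall>f\<in>chaos_space 7. chaos_norm 7 f < e \<longrightarrow> f \<in> V"
    using assms unfolding chaos_basic_nhd_def by simp
  then obtain e where e: "e > 0" "\<And>f. f \<in> chaos_space 7 \<Longrightarrow> chaos_norm 7 f < e \<Longrightarrow> f \<in> V"
    by blast
  have "chaos_series c \<in> V" if c: "\<And>n. cmod (c n) \<le> B * 10 ^ n" and B: "B < e" for c B
  proof (rule e(2))
    show "chaos_series c \<in> chaos_space 7" using chaos_series_geometric(1)[of c B 10 7] c by simp
    have "0 \<le> B" using c[of 0] norm_ge_zero[of "c 0"] by (simp, linarith)
    \<comment> \<open>Here 28 = 2^7 - 10^2; since its root exceeds 1, the radius of the ball itself
      serves as \<open>d\<close>.\<close>
    then have "B / sqrt 28 \<le> B / 1" by (intro divide_left_mono) auto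
    then show "chaos_norm 7 (chaos_series c) < e"
      using chaos_series_geometric(2)[of c B 10 7] c B by simp
  qed
  with e(1) show ?thesis using that by blast
qed


section \<open>The process\<close>

text \<open>The segment integral is a primitive \<open>F\<close> of \<open>f\<close>, so the left
  side is the first-order Taylor remainder of \<open>F\<close>. Its second derivative
  \<open>deriv f\<close> is bounded by Cauchy's inequality on unit circles, which is why
  \<open>f\<close> is controlled on the disc of radius \<open>R + 1\<close>.\<close>

lemma entire_primitive_Taylor:
  assumes f: "f holomorphic_on UNIV" and B: "\<And>u. cmod u \<le> R + 1 \<Longrightarrow> cmod (f u) \<le> B"
    and zw: "cmod z \<le> R" "cmod w \<le> R"
  shows "cmod (contour_integral (linepath 0 w) f - contour_integral (linepath 0 z) f - f z * (w - z))
    \<le> B * (cmod (w - z))\<^sup>2"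
proof -
  let ?F = "\<lambda>w. contour_integral (linepath 0 w) f"
  \<comment> \<open>Entries 0, 1 and 2 are \<open>F\<close> and its first two derivatives, in the
    form expected by \<open>complex_Taylor\<close>.\<close>
  let ?G = "\<lambda>i::nat. if i = 0 then ?F else if i = 1 then f else deriv f"
  obtain g where g: "\<And>x. (g has_field_derivative f x) (at x)"
    using holomorphic_convex_primitive'[of UNIV f] f by auto
  have "?F x = g x - g 0" for x
    using contour_integral_primitive[of UNIV g f "linepath 0 x"] g
    by (auto intro: contour_integral_unique)
  then have F: "(?F has_field_derivative f x) (at x)" for x
    using g by (auto intro!: derivative_eq_intros)
  have f': "(f has_field_derivative deriv f x) (at x)" for x
    using f by (simp add: holomorphic_derivI)
  have bound: "cmod (deriv f x) \<le> B" if "cmod x \<le> R" for x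
  proof -
    have "cmod ((deriv ^^ 1) f x) \<le> fact 1 * B / 1 ^ 1"
    proof (rule Cauchy_inequality)
      show "f holomorphic_on ball x 1" "continuous_on (cball x 1) f"
        using f holomorphic_on_imp_continuous_on[OF f]
        by (auto intro: holomorphic_on_subset continuous_on_subset)
      fix y assume "cmod (x - y) = 1"
      then show "cmod (f y) \<le> B"
        using that norm_triangle_sub[of y x] by (intro B) (simp add: norm_minus_commute)
    qed auto
    then show ?thesis by simp
  qed
  have "cmod (?G 0 w - (\<Sum>i\<le>1. ?G i z * (w - z) ^ i / fact i)) \<le> B * cmod (w - z) ^ Suc 1 / fact 1"
  proof (rule complex_Taylor[of "cball 0 R" 1 ?G B z w])
    show "(?G i has_field_derivative ?G (Suc i) x) (at x within cball 0 R)" if "i \<le> 1" for i x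
      using that F f' by (cases "i = 0") (auto intro: has_field_derivative_at_within)
  qed (use zw bound in auto)
  then show ?thesis by (simp add: algebra_simps power2_eq_square)
qed

theorem theorem9p2:
  fixes m :: "complex \<Rightarrow> complex"
  assumes entire: "m holomorphic_on UNIV"
    and pos: "\<And>x::real. x \<ge> 0 \<Longrightarrow> m (of_real x) \<in> \<real> \<and> Re (m (of_real x)) > 0"
    and root: "\<exists>g. g holomorphic_on UNIV \<and> (\<forall>z. (g z)\<^sup>2 = m z)"
  shows "(\<forall>z. noise_process m z \<in> chaos_dist) \<and>
    (\<forall>z. has_chaos_derivative (noise_process m)
           (\<lambda>\<alpha>. entire_sqrt m z * complex_white_noise z \<alpha>) z) \<and>
    (\<forall>K. compact K \<longrightarrow>
       chaos_uniform_limit K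
         (\<lambda>N z \<alpha>. entire_sqrt m z * (\<Sum>n<N. hermite_zeta n z * chaos_Z n \<alpha>))
         (\<lambda>z \<alpha>. entire_sqrt m z * complex_white_noise z \<alpha>))"
proof -
  let ?r = "entire_sqrt m"
  \<comment> \<open>Absorbing the square root makes the process and its derivative series with
    coefficients \<open>?F n z\<close> and \<open>f n z\<close>, the first being primitives of the
    second.\<close>
  define f where "f = (\<lambda>n u. ?r u * hermite_zeta n u)"
  let ?F = "\<lambda>n z. contour_integral (linepath 0 z) (f n)"
  have r: "?r holomorphic_on UNIV"
    using root is_entire_sqrt_entire_sqrt[of m, OF pos] unfolding is_entire_sqrt_def by blast
  have f: "f n holomorphic_on UNIV" for n
    unfolding f_def by (intro holomorphic_intros r hermite_zeta_holomorphic)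
  have f_bound: "\<exists>C\<ge>0. \<forall>n u. cmod u \<le> R \<longrightarrow> cmod (f n u) \<le> C * 9 ^ n" for R
  proof -
    have "compact (?r ` cball 0 R)"
      using holomorphic_on_imp_continuous_on[OF r] continuous_on_subset
      by (intro compact_continuous_image) auto
    then obtain M where M: "M > 0" "\<And>u. cmod u \<le> R \<Longrightarrow> cmod (?r u) \<le> M"
      using compact_imp_bounded bounded_pos by (metis image_eqI mem_cball_0)
    have "cmod (f n u) \<le> M * exp (4 * R\<^sup>2 + 2) * 9 ^ n" if "cmod u \<le> R" for n u
      unfolding f_def norm_mult mult.assoc using M that norm_hermite_zeta_le[OF that]
      by (intro mult_mono) auto
    then show ?thesis using M(1) by (intro exI[of _ "M * exp (4 * R\<^sup>2 + 2)"]) auto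
  qed
  have nine_ten: "C * 9 ^ n \<le> C * 10 ^ n" if "C \<ge> 0" for C :: real and n :: nat
    using that by (intro mult_left_mono power_mono) auto
  have process: "noise_process m z = chaos_series (\<lambda>n. ?F n z)" for z
    by (simp add: noise_process_def f_def)
  have noise: "(\<lambda>\<alpha>. ?r z * complex_white_noise z \<alpha>) = chaos_series (\<lambda>n. f n z)" for z
  proof
    fix \<alpha>
    show "?r z * complex_white_noise z \<alpha> = chaos_series (\<lambda>n. f n z) \<alpha>"
      by (cases \<alpha> rule: chaos_index_cases) (simp_all add: complex_white_noise_def f_def)
  qed
  have noise_dist: "chaos_series (\<lambda>n. f n z) \<in> chaos_dist" for z
  proof -
    obtain C where "C \<ge> 0" "\<And>n. cmod (f n z) \<le> C * 9 ^ n" using f_bound[of "cmod z"] by auto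
    then show ?thesis
      by (intro chaos_series_geometric_in_dist[where B = C]) (meson nine_ten order_trans)
  qed
  have Taylor: "\<exists>C\<ge>0. \<forall>n z w. cmod z \<le> R \<longrightarrow> cmod w \<le> R \<longrightarrow>
      cmod (?F n w - ?F n z - f n z * (w - z)) \<le> C * (cmod (w - z))\<^sup>2 * 10 ^ n" for R
  proof -
    obtain C where C: "C \<ge> 0" "\<And>n u. cmod u \<le> R + 1 \<Longrightarrow> cmod (f n u) \<le> C * 10 ^ n"
      using f_bound[of "R + 1"] nine_ten by (meson order_trans)
    have "cmod (?F n w - ?F n z - f n z * (w - z)) \<le> C * (cmod (w - z))\<^sup>2 * 10 ^ n"
      if "cmod z \<le> R" "cmod w \<le> R" for n z w
      using entire_primitive_Taylor[OF f C(2) that] by (simp add: mult_ac)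
    with C(1) show ?thesis by blast
  qed
  have process_dist: "noise_process m z \<in> chaos_dist" for z
  proof -
    \<comment> \<open>Taylor's bound with base point 0, where \<open>?F n\<close> vanishes. Adding
      back \<open>z\<close> times the series of \<open>f n 0\<close> recovers the process.\<close>
    obtain C where C: "\<And>n. cmod (?F n z - f n 0 * z) \<le> C * (cmod z)\<^sup>2 * 10 ^ n"
      using Taylor[of "cmod z"] by (metis (no_types, lifting) norm_zero norm_ge_zero
        contour_integral_trivial diff_zero order_refl)
    have "noise_process m z =
        (\<lambda>\<alpha>. 1 * chaos_series (\<lambda>n. ?F n z - f n 0 * z) \<alpha> + z * chaos_series (\<lambda>n. f n 0) \<alpha>)"
      unfolding process
    proof
      fix \<alpha>
      show "chaos_series (\<lambda>n. ?F n z) \<alpha> = 1 * chaos_series (\<lambda>n. ?F n z - f n 0 * z) \<alpha>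
          + z * chaos_series (\<lambda>n. f n 0) \<alpha>"
        by (cases \<alpha> rule: chaos_index_cases) simp_all
    qed
    also have "\<dots> \<in> chaos_dist"
      by (intro chaos_dist_lincomb noise_dist chaos_series_geometric_in_dist[OF C])
    finally show ?thesis .
  qed
  have derivative: "has_chaos_derivative (noise_process m)
           (\<lambda>\<alpha>. ?r z * complex_white_noise z \<alpha>) z" for z
    unfolding has_chaos_derivative_def noise limitin_def topspace_chaos_topology
  proof (intro conjI allI impI noise_dist)
    fix U assume "openin chaos_topology U \<and> chaos_series (\<lambda>n. f n z) \<in> U"
    then obtain V where V: "chaos_basic_nhd V"
      "\<And>h. h \<in> V \<Longrightarrow> (\<lambda>\<alpha>. chaos_series (\<lambda>n. f n z) \<alpha> + h \<alpha>) \<in> U"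
      unfolding openin_chaos_topology chaos_open_def by blast
    obtain d where d: "d > 0"
      "\<And>c B. (\<And>n. cmod (c n) \<le> B * 10 ^ n) \<Longrightarrow> B < d \<Longrightarrow> chaos_series c \<in> V"
      using chaos_basic_nhd_geometric[OF V(1)] by blast
    obtain C where C: "C \<ge> 0" "\<And>n w. cmod w \<le> cmod z + 1 \<Longrightarrow>
      cmod (?F n w - ?F n z - f n z * (w - z)) \<le> C * (cmod (w - z))\<^sup>2 * 10 ^ n"
      using Taylor[of "cmod z + 1"] by auto
    \<comment> \<open>The bound 1 keeps \<open>w\<close> in the disc on which \<open>C\<close> is
      valid; \<open>C + 1\<close> avoids division by zero.\<close>
    define e where "e = min 1 (d / (C + 1))"
    have "e > 0" using d(1) C(1) by (simp add: e_def)
    show "\<forall>\<^sub>F w in at z. (\<lambda>\<alpha>. (noise_process m w \<alpha> - noise_process m z \<alpha>) / (w - z)) \<in> U"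
      unfolding eventually_at
    proof (intro exI[of _ e] conjI ballI impI \<open>e > 0\<close>)
      fix w assume "w \<noteq> z \<and> dist w z < e"
      then have w: "w \<noteq> z" "cmod (w - z) < e" by (auto simp: dist_norm)
      \<comment> \<open>These are the coefficients of the error. Dividing the quadratic remainder by
        \<open>w - z\<close> leaves a bound linear in \<open>cmod (w - z)\<close> with a constant
        independent of \<open>n\<close>, which lets \<open>d\<close> apply to the whole
        series.\<close>
      define c where "c = (\<lambda>n. (?F n w - ?F n z) / (w - z) - f n z)"
      have "cmod w \<le> cmod z + 1"
        using w(2) norm_triangle_sub[of w z] by (simp add: e_def)
      have "cmod (c n) \<le> C * cmod (w - z) * 10 ^ n" for n
      proof -
        have "c n = (?F n w - ?F n z - f n z * (w - z)) / (w - z)"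
          using w by (simp add: c_def field_simps)
        also have "cmod \<dots> \<le> C * (cmod (w - z))\<^sup>2 * 10 ^ n / cmod (w - z)"
          unfolding norm_divide by (intro divide_right_mono C(2) \<open>cmod w \<le> cmod z + 1\<close>) auto
        also have "\<dots> = C * cmod (w - z) * 10 ^ n" using w by (simp add: power2_eq_square)
        finally show ?thesis .
      qed
      moreover have "C * cmod (w - z) < d"
      proof -
        have "C * cmod (w - z) \<le> (C + 1) * cmod (w - z)" by (simp add: algebra_simps)
        also have "\<dots> < (C + 1) * (d / (C + 1))"
          using w(2) C(1) by (intro mult_strict_left_mono) (auto simp: e_def)
        finally show ?thesis using C(1) by simp
      qed
      ultimately have "chaos_series c \<in> V" by (rule d(2))
      moreover have "(\<lambda>\<alpha>. (noise_process m w \<alpha> - noise_process m z \<alpha>) / (w - z)) =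
          (\<lambda>\<alpha>. chaos_series (\<lambda>n. f n z) \<alpha> + chaos_series c \<alpha>)"
        unfolding process
      proof
        fix \<alpha>
        show "(chaos_series (\<lambda>n. ?F n w) \<alpha> - chaos_series (\<lambda>n. ?F n z) \<alpha>) / (w - z) =
            chaos_series (\<lambda>n. f n z) \<alpha> + chaos_series c \<alpha>"
          by (cases \<alpha> rule: chaos_index_cases) (simp_all add: c_def)
      qed
      ultimately show "(\<lambda>\<alpha>. (noise_process m w \<alpha> - noise_process m z \<alpha>) / (w - z)) \<in> U"
        using V(2) by simp
    qed
  qed
  have partial: "(\<lambda>\<alpha>. ?r z * (\<Sum>n<N. hermite_zeta n z * chaos_Z n \<alpha>)) =
      chaos_series (\<lambda>n. if n < N then f n z else 0)" for N z
  proof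
    fix \<alpha>
    show "?r z * (\<Sum>n<N. hermite_zeta n z * chaos_Z n \<alpha>) =
        chaos_series (\<lambda>n. if n < N then f n z else 0) \<alpha>"
    proof (cases \<alpha> rule: chaos_index_cases)
      case (1 k)
      have "(\<Sum>n<N. hermite_zeta n z * chaos_Z n \<alpha>) = (\<Sum>n<N. if n = k then hermite_zeta n z else 0)"
        unfolding 1(2) by (intro sum.cong) auto
      then show ?thesis by (simp add: 1(1) f_def)
    qed simp
  qed
  have uniform: "chaos_uniform_limit K
         (\<lambda>N z \<alpha>. ?r z * (\<Sum>n<N. hermite_zeta n z * chaos_Z n \<alpha>))
         (\<lambda>z \<alpha>. ?r z * complex_white_noise z \<alpha>)" if K: "compact K" for K
  proof -
    obtain R where R: "\<And>z. z \<in> K \<Longrightarrow> cmod z \<le> R"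
      using compact_imp_bounded[OF K] by (auto simp: bounded_iff)
    obtain C where C: "C \<ge> 0" "\<And>n z. z \<in> K \<Longrightarrow> cmod (f n z) \<le> C * 9 ^ n"
      using f_bound[of R] R by metis
    have partial_dist: "chaos_series (\<lambda>n. if n < N then f n z else 0) \<in> chaos_dist" if "z \<in> K" for N z
    proof (rule chaos_series_geometric_in_dist)
      show "cmod (if n < N then f n z else 0) \<le> C * 10 ^ n" for n
        using C(1) C(2)[OF that, of n] nine_ten[OF C(1), of n] by auto
    qed
    have "\<forall>\<^sub>F N in sequentially. \<forall>z\<in>K. (\<lambda>\<alpha>. chaos_series (\<lambda>n. if n < N then f n z else 0) \<alpha>
        - chaos_series (\<lambda>n. f n z) \<alpha>) \<in> U"
      if U: "openin chaos_topology U \<and> (\<lambda>_. 0) \<in> U" for U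
    proof -
      obtain V where V: "chaos_basic_nhd V" "\<And>h. h \<in> V \<Longrightarrow> h \<in> U"
        using U unfolding openin_chaos_topology chaos_open_def by force
      obtain d where d: "d > 0"
        "\<And>c B. (\<And>n. cmod (c n) \<le> B * 10 ^ n) \<Longrightarrow> B < d \<Longrightarrow> chaos_series c \<in> V"
        using chaos_basic_nhd_geometric[OF V(1)] by blast
      \<comment> \<open>Measured against 10^n, the tail from \<open>N\<close> on has constant C
        (9/10)^N. It does not depend on \<open>z\<close> in \<open>K\<close>, whence
        uniformity.\<close>
      have "(\<lambda>N. C * (9 / 10) ^ N) \<longlonglongrightarrow> C * 0"
        by (intro tendsto_intros LIMSEQ_realpow_zero) auto
      then have "\<forall>\<^sub>F N in sequentially. C * (9 / 10) ^ N < d"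
        using d(1) by (intro order_tendstoD) auto
      then show ?thesis
      proof eventually_elim
        case (elim N)
        show ?case
        proof
          fix z assume z: "z \<in> K"
          \<comment> \<open>The sign is negative because the limit is subtracted from the partial
            sum.\<close>
          define c where "c = (\<lambda>n. if n < N then 0 else - f n z)"
          have "cmod (c n) \<le> C * (9 / 10) ^ N * 10 ^ n" for n
          proof (cases "n < N")
            case False
            have "cmod (c n) \<le> C * 9 ^ n" using C(2)[OF z] False by (simp add: c_def)
            also have "\<dots> = C * (9 / 10) ^ n * 10 ^ n" by (simp add: power_divide)
            also have "\<dots> \<le> C * (9 / 10) ^ N * 10 ^ n"
              using False C(1) by (intro mult_right_mono mult_left_mono power_decreasing) auto
            finally show ?thesis .
          qed (use C(1) in \<open>simp add: c_def\<close>)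
          then have "chaos_series c \<in> U" using V(2) d(2) elim by blast
          moreover have "(\<lambda>\<alpha>. chaos_series (\<lambda>n. if n < N then f n z else 0) \<alpha>
              - chaos_series (\<lambda>n. f n z) \<alpha>) = chaos_series c"
          proof
            fix \<alpha>
            show "chaos_series (\<lambda>n. if n < N then f n z else 0) \<alpha>
                - chaos_series (\<lambda>n. f n z) \<alpha> = chaos_series c \<alpha>"
              by (cases \<alpha> rule: chaos_index_cases) (simp_all add: c_def)
          qed
          ultimately show "(\<lambda>\<alpha>. chaos_series (\<lambda>n. if n < N then f n z else 0) \<alpha>
              - chaos_series (\<lambda>n. f n z) \<alpha>) \<in> U" by simp
        qed
      qed
    qed
    \<comment> \<open>The definition evaluates the families at each index inside the difference, so
      \<open>partial\<close> and \<open>noise\<close> are also used in pointwise form.\<close>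
    then show ?thesis
      unfolding chaos_uniform_limit_def partial noise
      using noise_dist partial_dist
      by (simp add: partial[unfolded fun_eq_iff] noise[unfolded fun_eq_iff])
  qed
  from process_dist derivative uniform show ?thesis by blast
qed

end
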